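(* Let $K$ be a finite simplicial complex and let $d\ge 0$ be an integer. The wreath product $\partial\Delta_d\wr K$ is non-evasive if and only if $K$ is non-evasive.
   Context: Simplicial complexes are finite abstract simplicial complexes, $K\neq\emptyset$; the empty set is a face. Wreath product: let $K$ have vertices $v_1,\dots,v_n$ and let $\Delta_d$ be an abstract $d$-simplex ($d+1$ vertices). The simplicial complex $\partial\Delta_d\wr K$ has as vertices $d+1$ copies $v_k^1,\dots,v_k^{d+1}$ of each vertex $v_k$ of $K$ ($1\le k\le n$). Its facets are exactly the sets obtained as follows: choose a facet $F$ of $K$; take all $d+1$ copies of every vertex $v\in F$, and for every vertex $v\notin F$ take all copies of $v$ except exactly one (arbitrarily chosen) copy. Link and deletion: for a vertex $v$ of $K$, $\operatorname{link}_K(v)=\{F\in K: v\notin F,\ \{v\}\cup F\in K\}$ and $\operatorname{del}_K(v)=\{F\in K: v\notin F\}$. Non-evasive (recursive definition): $K$ is non-evasive if either $K$ is a single point (one vertex), or there is a vertex $v$ of $K$ such that both $\operatorname{link}_K(v)$ and $\operatorname{del}_K(v)$ are non-evasive. *)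

theory Defs
  imports Main
begin

definition abstract_simplicial_complex :: "'a set set \<Rightarrow> bool" where
  "abstract_simplicial_complex K \<longleftrightarrow>
     finite K \<and> K \<noteq> {} \<and> (\<forall>F\<in>K. finite F \<and> (\<forall>G. G \<subseteq> F \<longrightarrow> G \<in> K))"

definition vertices :: "'a set set \<Rightarrow> 'a set" where
  "vertices K = {v. {v} \<in> K}"

definition facets :: "'a set set \<Rightarrow> 'a set set" where
  "facets K = {F \<in> K. \<forall>G\<in>K. F \<subseteq> G \<longrightarrow> G = F}"

definition link :: "'a set set \<Rightarrow> 'a \<Rightarrow> 'a set set" where
  "link K v = {F \<in> K. v \<notin> F \<and> insert v F \<in> K}"

definition deletion :: "'a set set \<Rightarrow> 'a \<Rightarrow> 'a set set" where
  "deletion K v = {F \<in> K. v \<notin> F}"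

text \<open>The pair \<open>(v, i)\<close> is the \<open>i\<close>-th copy of the vertex \<open>v\<close>. For a facet \<open>F\<close> of \<open>K\<close>,
  \<open>c v\<close> is the index of the copy of \<open>v\<close> that is left out when \<open>v \<notin> F\<close>.\<close>

definition wreath_facet :: "nat \<Rightarrow> 'a set set \<Rightarrow> 'a set \<Rightarrow> ('a \<Rightarrow> nat) \<Rightarrow> ('a \<times> nat) set" where
  "wreath_facet d K F c =
     {(v, i). v \<in> vertices K \<and> i \<in> {1..d + 1} \<and> (v \<notin> F \<longrightarrow> i \<noteq> c v)}"

text \<open>The wreath product of the boundary of the abstract \<open>d\<close>-simplex with \<open>K\<close>, given as the set
  of all its faces.\<close>

definition simplex_boundary_wreath :: "nat \<Rightarrow> 'a set set \<Rightarrow> ('a \<times> nat) set set" where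
  "simplex_boundary_wreath d K =
     {S. \<exists>F\<in>facets K. \<exists>c. (\<forall>v\<in>vertices K - F. c v \<in> {1..d + 1}) \<and> S \<subseteq> wreath_facet d K F c}"

inductive nonevasive :: "'a set set \<Rightarrow> bool" where
  point: "nonevasive {{}, {v}}"
| step: "nonevasive K"
    if "v \<in> vertices K" "nonevasive (link K v)" "nonevasive (deletion K v)"

lemma finite_vertices:
  assumes "abstract_simplicial_complex K"
  shows "finite (vertices K)"
proof -
  have "vertices K \<subseteq> \<Union>K" by (auto simp: vertices_def)
  then show ?thesis
    using assms by (meson abstract_simplicial_complex_def finite_Union finite_subset)
qed

lemma facet_exists:
  assumes "abstract_simplicial_complex K" "G \<in> K"
  shows "\<exists>F\<in>facets K. G \<subseteq> F"
proof -
  have "finite K" using assms by (simp add: abstract_simplicial_complex_def)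
  then obtain F where "F \<in> K" "G \<subseteq> F" "\<forall>H\<in>K. F \<subseteq> H \<longrightarrow> F = H"
    using finite_has_maximal2[of K G] assms(2) by metis
  then show ?thesis
    unfolding facets_def by (intro bexI[of _ F]) auto
qed

lemma abstract_simplicial_complex_deletion:
  assumes K: "abstract_simplicial_complex K"
  shows "abstract_simplicial_complex (deletion K v)"
proof -
  have down: "\<And>F G. F \<in> K \<Longrightarrow> G \<subseteq> F \<Longrightarrow> G \<in> K"
    and fin: "finite K" "\<And>F. F \<in> K \<Longrightarrow> finite F"
    using K unfolding abstract_simplicial_complex_def by blast+
  obtain F where "F \<in> K"
    using K unfolding abstract_simplicial_complex_def by blast
  then have "{} \<in> deletion K v"
    using down[of F "{}"] by (simp add: deletion_def)
  moreover have "G \<in> deletion K v" if "F \<in> deletion K v" "G \<subseteq> F" for F G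
    using that down[of F G] by (auto simp: deletion_def)
  moreover have "finite (deletion K v)" "\<And>F. F \<in> deletion K v \<Longrightarrow> finite F"
    using fin by (simp_all add: deletion_def)
  ultimately show ?thesis
    unfolding abstract_simplicial_complex_def by blast
qed

lemma abstract_simplicial_complex_link:
  assumes K: "abstract_simplicial_complex K" and v: "v \<in> vertices K"
  shows "abstract_simplicial_complex (link K v)"
proof -
  have down: "\<And>F G. F \<in> K \<Longrightarrow> G \<subseteq> F \<Longrightarrow> G \<in> K"
    and fin: "finite K" "\<And>F. F \<in> K \<Longrightarrow> finite F"
    using K unfolding abstract_simplicial_complex_def by blast+
  have "{} \<in> link K v"
    using v down[of "{v}" "{}"] by (auto simp: link_def vertices_def)
  moreover have "G \<in> link K v" if "F \<in> link K v" "G \<subseteq> F" for F G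
    using that down[of F G] down[of "insert v F" "insert v G"] by (auto simp: link_def)
  moreover have "finite (link K v)" "\<And>F. F \<in> link K v \<Longrightarrow> finite F"
    using fin by (simp_all add: link_def)
  ultimately show ?thesis
    unfolding abstract_simplicial_complex_def by blast
qed

lemma abstract_simplicial_complex_wreath:
  assumes K: "abstract_simplicial_complex K"
  shows "abstract_simplicial_complex (simplex_boundary_wreath d K)"
proof -
  let ?V = "vertices K \<times> {1..d + 1}"
  have fin: "finite ?V" using finite_vertices[OF K] by simp
  have sub: "simplex_boundary_wreath d K \<subseteq> Pow ?V"
    by (auto simp: simplex_boundary_wreath_def wreath_facet_def)
  obtain G where "G \<in> K"
    using K unfolding abstract_simplicial_complex_def by blast
  then obtain F where "F \<in> facets K"
    using facet_exists[OF K, of G] by blast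
  then have "{} \<in> simplex_boundary_wreath d K"
    unfolding simplex_boundary_wreath_def by (auto intro!: bexI[of _ F] exI[of _ "\<lambda>_. 1"])
  moreover have "finite (simplex_boundary_wreath d K)"
    using finite_subset[OF sub] fin by simp
  moreover have "finite S" if "S \<in> simplex_boundary_wreath d K" for S
    using finite_subset[OF _ fin] sub that by blast
  moreover have "T \<in> simplex_boundary_wreath d K"
    if "S \<in> simplex_boundary_wreath d K" "T \<subseteq> S" for S T
    using that unfolding simplex_boundary_wreath_def by blast
  ultimately show ?thesis
    unfolding abstract_simplicial_complex_def by blast
qed

text \<open>The sets \<open>wreath_facet d K F c\<close> are exactly the facets, not merely a generating family.\<close>

lemma facets_simplex_boundary_wreath:
  assumes K: "abstract_simplicial_complex K"
  shows "facets (simplex_boundary_wreath d K) =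
    {wreath_facet d K F c | F c. F \<in> facets K \<and> (\<forall>v\<in>vertices K - F. c v \<in> {1..d + 1})}"
    (is "_ = ?W")
proof
  have face: "T \<in> simplex_boundary_wreath d K" if "T \<in> ?W" for T
    using that unfolding simplex_boundary_wreath_def by blast
  have below: "\<exists>T\<in>?W. S \<subseteq> T" if "S \<in> simplex_boundary_wreath d K" for S
    using that unfolding simplex_boundary_wreath_def by blast
  show "facets (simplex_boundary_wreath d K) \<subseteq> ?W"
  proof
    fix S assume S: "S \<in> facets (simplex_boundary_wreath d K)"
    then have "S \<in> simplex_boundary_wreath d K" by (simp add: facets_def)
    from below[OF this] obtain T where T: "T \<in> ?W" "S \<subseteq> T" ..
    then have "T = S" using S face[OF T(1)] by (simp add: facets_def)
    then show "S \<in> ?W" using T by simp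
  qed
  have anti: "T = S" if S: "S \<in> ?W" and T: "T \<in> ?W" and le: "S \<subseteq> T" for S T
  proof -
    obtain F c where F: "F \<in> facets K" and c: "\<forall>v\<in>vertices K - F. c v \<in> {1..d + 1}"
      and S_eq: "S = wreath_facet d K F c" using S by blast
    obtain G b where G: "G \<in> facets K" and b: "\<forall>v\<in>vertices K - G. b v \<in> {1..d + 1}"
      and T_eq: "T = wreath_facet d K G b" using T by blast
    have FV: "F \<subseteq> vertices K"
    proof
      fix v assume "v \<in> F"
      then have "{v} \<subseteq> F" by simp
      moreover have "F \<in> K" using F by (simp add: facets_def)
      ultimately show "v \<in> vertices K"
        using K by (simp add: vertices_def abstract_simplicial_complex_def)
    qed
    have "F \<subseteq> G"
    proof
      fix v assume v: "v \<in> F"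
      show "v \<in> G"
      proof (rule ccontr)
        assume nv: "v \<notin> G"
        then have "b v \<in> {1..d + 1}" using b v FV by blast
        then have "(v, b v) \<in> S" using v FV by (auto simp: S_eq wreath_facet_def)
        then have "(v, b v) \<in> T" using le by blast
        then show False using nv by (simp add: T_eq wreath_facet_def)
      qed
    qed
    then have FG: "G = F" using F G by (simp add: facets_def)
    have "b v = c v" if v: "v \<in> vertices K" "v \<notin> F" for v
    proof (rule ccontr)
      assume ne: "b v \<noteq> c v"
      have "b v \<in> {1..d + 1}" using b v FG by blast
      then have "(v, b v) \<in> S" using v ne by (simp add: S_eq wreath_facet_def)
      then have "(v, b v) \<in> T" using le by blast
      then show False using v FG by (simp add: T_eq wreath_facet_def)
    qed
    then show ?thesis by (auto simp: S_eq T_eq FG wreath_facet_def)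
  qed
  show "?W \<subseteq> facets (simplex_boundary_wreath d K)"
  proof
    fix S assume S: "S \<in> ?W"
    have "T = S" if "T \<in> simplex_boundary_wreath d K" "S \<subseteq> T" for T
    proof -
      from below[OF that(1)] obtain U where U: "U \<in> ?W" "T \<subseteq> U" ..
      then have "U = S" using anti[OF S U(1)] that(2) by (meson subset_trans)
      then show ?thesis using U(2) that(2) by simp
    qed
    then show "S \<in> facets (simplex_boundary_wreath d K)"
      using face[OF S] by (simp add: facets_def)
  qed
qed

end

(* Faces of the wreath product are the sets of copies whose core, the set of vertices all of whose
   copies are present, is a face of K. Allow the vertices to have different numbers of copies and
   induct on the total number of copies. If v has at least two copies, the link of one copy just
   removes that copy, while its deletion is a cone over any other copy of v, hence non-evasive.
   If x is the only copy of v, then link and deletion of x come from link and deletion of v in K. *)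

theory Submission
  imports Defs
begin

section \<open>Cones\<close>

lemma complex_down:
  "abstract_simplicial_complex K \<Longrightarrow> F \<in> K \<Longrightarrow> G \<subseteq> F \<Longrightarrow> G \<in> K"
  unfolding abstract_simplicial_complex_def by blast

lemma complex_empty_face: "abstract_simplicial_complex K \<Longrightarrow> {} \<in> K"
  unfolding abstract_simplicial_complex_def by blast

text \<open>The apex stays an apex: link and deletion of any vertex other than \<open>a\<close> are
  again cones over \<open>a\<close>, with fewer faces, since \<open>{v}\<close> lies in neither. If
  \<open>a\<close> is the only vertex, the complex is a point.\<close>

lemma nonevasive_cone:
  assumes "abstract_simplicial_complex L" "\<And>S. S \<in> L \<Longrightarrow> insert a S \<in> L"
  shows "nonevasive L"
  using assms
proof (induction "card L" arbitrary: L rule: less_induct)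
  case less
  note L = less.prems(1) and cone = less.prems(2)
  have fin: "finite L" using L by (simp add: abstract_simplicial_complex_def)
  have e: "{} \<in> L" using L by (rule complex_empty_face)
  show ?case
  proof (cases "\<exists>v\<in>vertices L. v \<noteq> a")
    case False
    have "S \<subseteq> {a}" if "S \<in> L" for S
    proof
      fix w assume "w \<in> S"
      then have "{w} \<in> L" using complex_down[OF L that] by simp
      then show "w \<in> {a}" using False by (simp add: vertices_def)
    qed
    then have "L = {{}, {a}}" using e cone[OF e] by blast
    then show ?thesis by (simp add: nonevasive.point)
  next
    case True
    then obtain v where v: "v \<in> vertices L" "v \<noteq> a" by blast
    then have vL: "{v} \<in> L" by (simp add: vertices_def)
    have "link L v \<subset> L" "deletion L v \<subset> L"
      using vL by (auto simp: link_def deletion_def)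
    then have "card (link L v) < card L" "card (deletion L v) < card L"
      using fin by (simp_all add: psubset_card_mono)
    moreover have "insert a S \<in> link L v" if "S \<in> link L v" for S
      using that v(2) cone[of S] cone[of "insert v S"] by (simp add: link_def insert_commute)
    moreover have "insert a S \<in> deletion L v" if "S \<in> deletion L v" for S
      using that v(2) cone[of S] by (simp add: deletion_def)
    ultimately have "nonevasive (link L v)" "nonevasive (deletion L v)"
      using less.hyps[of "link L v"] less.hyps[of "deletion L v"]
        abstract_simplicial_complex_link[OF L v(1)] abstract_simplicial_complex_deletion[OF L]
      by blast+
    then show ?thesis using v(1) by (blast intro: nonevasive.step)
  qed
qed

section \<open>Inflated complexes\<close>

text \<open>The elements of \<open>W\<close> are the copies, \<open>x\<close> being a copy of \<open>p x\<close>. Elements of \<open>p ` W\<close> that are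
  not vertices of \<open>K\<close> are allowed; they arise from links and deletions.\<close>

definition core :: "('b \<Rightarrow> 'a) \<Rightarrow> 'b set \<Rightarrow> 'b set \<Rightarrow> 'a set" where
  "core p W S = p ` W - p ` (W - S)"

text \<open>For a complex \<open>K\<close> whose vertex set is the image of \<open>W\<close> under
  \<open>p\<close>, this is an iterated simplicial wedge: the minimal nonfaces are those of
  \<open>K\<close> with each vertex replaced by all of its copies. Fibres of different sizes are
  allowed because the link of a single copy destroys uniformity.\<close>

definition inflation :: "('b \<Rightarrow> 'a) \<Rightarrow> 'b set \<Rightarrow> 'a set set \<Rightarrow> 'b set set" where
  "inflation p W K = {S. S \<subseteq> W \<and> core p W S \<in> K}"

lemma core_mono: "S \<subseteq> T \<Longrightarrow> core p W S \<subseteq> core p W T"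
  unfolding core_def by blast

lemma core_subset: "core p W S \<subseteq> p ` S"
  unfolding core_def by blast

lemma core_empty [simp]: "core p W {} = {}"
  by (simp add: core_def)

lemma abstract_simplicial_complex_inflation:
  assumes K: "abstract_simplicial_complex K" and W: "finite W"
  shows "abstract_simplicial_complex (inflation p W K)"
proof -
  have sub: "inflation p W K \<subseteq> Pow W" by (auto simp: inflation_def)
  then have "finite (inflation p W K)" using W by (simp add: finite_subset)
  moreover have "{} \<in> inflation p W K"
    using complex_empty_face[OF K] by (simp add: inflation_def)
  moreover have "finite S" if "S \<in> inflation p W K" for S
    using that sub W finite_subset by blast
  moreover have "T \<in> inflation p W K" if "S \<in> inflation p W K" "T \<subseteq> S" for S T
    using that complex_down[OF K _ core_mono[OF that(2)]] by (auto simp: inflation_def)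
  ultimately show ?thesis unfolding abstract_simplicial_complex_def by blast
qed

section \<open>Links and deletions of a single copy\<close>

text \<open>Once \<open>x\<close> is present, its vertex is complete as soon as the remaining copies
  are, and at least one copy remains.\<close>

lemma link_inflation_repeated:
  assumes K: "abstract_simplicial_complex K" and x: "x \<in> W" "p x \<in> p ` (W - {x})"
  shows "link (inflation p W K) x = inflation p (W - {x}) K"
proof -
  have core_eq: "core p W (insert x S) = core p (W - {x}) S" for S
  proof -
    have "p ` W = p ` (W - {x})" using x by (metis insert_Diff image_insert insert_absorb)
    moreover have "W - insert x S = W - {x} - S" by blast
    ultimately show ?thesis by (simp add: core_def)
  qed
  \<comment> \<open>The link also asks that \<open>S\<close> without \<open>x\<close> be a face;
    this follows from closure of \<open>K\<close> under subsets.\<close>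
  have "core p W S \<in> K" if "core p (W - {x}) S \<in> K" for S
    using complex_down[OF K that] core_mono[of S "insert x S" p W] core_eq by blast
  then have "S \<in> link (inflation p W K) x \<longleftrightarrow> S \<in> inflation p (W - {x}) K" for S
    using x(1) by (auto simp: link_def inflation_def core_eq subset_Diff_insert)
  then show ?thesis by blast
qed

lemma core_insert_unique:
  assumes "x \<in> W" "p x \<notin> p ` (W - {x})"
  shows "core p W (insert x S) = insert (p x) (core p (W - {x}) S)"
proof -
  have "p ` W = insert (p x) (p ` (W - {x}))" using assms(1) by blast
  moreover have "W - insert x S = W - {x} - S" by blast
  moreover have "p x \<notin> p ` (W - {x} - S)" using assms(2) by blast
  ultimately show ?thesis by (simp add: core_def insert_Diff_if)
qed

lemma core_remove_unique:
  assumes "x \<in> W" "p x \<notin> p ` (W - {x})" "x \<notin> S"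
  shows "core p W S = core p (W - {x}) S"
proof -
  have "p ` W = insert (p x) (p ` (W - {x}))" using assms(1) by blast
  moreover have "p ` (W - S) = insert (p x) (p ` (W - {x} - S))" using assms(1,3) by blast
  ultimately show ?thesis using assms(2) by (simp add: core_def)
qed

text \<open>Adding the sole copy of a vertex adds exactly that vertex to the core, and leaving it
  out keeps the vertex out.\<close>

lemma link_inflation_unique:
  assumes x: "x \<in> W" "p x \<notin> p ` (W - {x})"
  shows "link (inflation p W K) x = inflation p (W - {x}) (link K (p x))"
proof -
  \<comment> \<open>With no copy of \<open>p x\<close> left, the condition in
    \<open>link K (p x)\<close> that faces avoid \<open>p x\<close> holds automatically.\<close>
  have "p x \<notin> core p (W - {x}) S" for S using x(2) by (auto simp: core_def)
  then have "S \<in> link (inflation p W K) x \<longleftrightarrow> S \<in> inflation p (W - {x}) (link K (p x))" for S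
    using core_insert_unique[of x W p S, OF x] core_remove_unique[of x W p S, OF x] x(1)
    by (cases "x \<in> S") (auto simp: link_def inflation_def subset_Diff_insert)
  then show ?thesis by blast
qed

lemma deletion_inflation_unique:
  assumes x: "x \<in> W" "p x \<notin> p ` (W - {x})"
  shows "deletion (inflation p W K) x = inflation p (W - {x}) (deletion K (p x))"
proof -
  have "p x \<notin> core p (W - {x}) S" for S using x(2) by (auto simp: core_def)
  then have "S \<in> deletion (inflation p W K) x \<longleftrightarrow>
      S \<in> inflation p (W - {x}) (deletion K (p x))" for S
    using core_remove_unique[of x W p S, OF x]
    by (cases "x \<in> S") (auto simp: deletion_def inflation_def subset_Diff_insert)
  then show ?thesis by blast
qed

text \<open>The missing copy \<open>x\<close> already keeps \<open>p x\<close> out of every core, so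
  adding another copy \<open>y\<close> of the same vertex changes no core. The deletion is thus a
  cone with apex \<open>y\<close>.\<close>

lemma nonevasive_deletion_inflation_repeated:
  assumes K: "abstract_simplicial_complex K" and W: "finite W"
    and x: "x \<in> W" "p x \<in> p ` (W - {x})"
  shows "nonevasive (deletion (inflation p W K) x)"
proof -
  from x(2) obtain y where y: "y \<in> W" "y \<noteq> x" "p y = p x" by (metis DiffE imageE singletonI)
  have "insert y S \<in> deletion (inflation p W K) x"
    if S: "S \<in> deletion (inflation p W K) x" for S
  proof -
    have "x \<in> W - S" "x \<in> W - insert y S" using S x(1) y(2) by (auto simp: deletion_def)
    then have "p y \<in> p ` (W - insert y S)" using y(3) by (metis image_eqI)
    then have "p ` (W - insert y S) = p ` (W - S)" by blast
    then have "core p W (insert y S) = core p W S" by (simp add: core_def)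
    then show ?thesis using S y by (simp add: deletion_def inflation_def)
  qed
  then show ?thesis
    using nonevasive_cone abstract_simplicial_complex_deletion
      abstract_simplicial_complex_inflation[OF K W] by metis
qed

text \<open>One copy alone leaves another copy missing, so its core is empty. This covers also the
  case that \<open>p x\<close> is not a vertex of \<open>K\<close>.\<close>

lemma vertices_inflation_repeated:
  assumes K: "abstract_simplicial_complex K" and x: "x \<in> W" "p x \<in> p ` (W - {x})"
  shows "x \<in> vertices (inflation p W K)"
proof -
  have "core p W {x} = {}" using x(2) core_subset[of p W "{x}"] by (auto simp: core_def)
  then show ?thesis
    using complex_empty_face[OF K] x(1) by (simp add: vertices_def inflation_def)
qed

lemma vertices_inflation_unique:
  assumes x: "x \<in> W" "p x \<notin> p ` (W - {x})"
  shows "x \<in> vertices (inflation p W K) \<longleftrightarrow> p x \<in> vertices K"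
proof -
  have "core p W {x} = {p x}" using x core_subset[of p W "{x}"] by (auto simp: core_def)
  then show ?thesis using x(1) by (simp add: vertices_def inflation_def)
qed

section \<open>Base cases: points\<close>

text \<open>Each vertex of \<open>K\<close> has a copy, and such a copy is always a vertex of the
  inflation, so only one vertex is possible.\<close>

lemma inflation_eq_pointD:
  assumes K: "abstract_simplicial_complex K" and VW: "\<Union>K \<subseteq> p ` W"
    and B: "inflation p W K = {{}, {x}}"
  shows "K = {{}, {p x}}"
proof -
  have only: "y = x" if "y \<in> vertices (inflation p W K)" for y
    using that by (simp add: B vertices_def)
  have xB: "x \<in> vertices (inflation p W K)" by (simp add: B vertices_def)
  then have xW: "x \<in> W" by (auto simp: vertices_def inflation_def)
  \<comment> \<open>A second copy of \<open>p x\<close> would be a second vertex of the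
    inflation.\<close>
  have "p x \<notin> p ` (W - {x})"
  proof
    assume "p x \<in> p ` (W - {x})"
    then obtain y where y: "y \<in> W" "y \<noteq> x" "p y = p x" by (metis DiffE imageE singletonI)
    then have "p y \<in> p ` (W - {y})" using xW by (metis Diff_iff image_eqI singletonD)
    then show False using only vertices_inflation_repeated[OF K y(1)] y(2) by blast
  qed
  then have "{p x} \<in> K"
    using vertices_inflation_unique[of x W p, OF xW] xB by (simp add: vertices_def)
  moreover have "w = p x" if F: "F \<in> K" "w \<in> F" for F w
  proof -
    have wK: "{w} \<in> K" using complex_down[OF K F(1)] F(2) by simp
    obtain y where y: "y \<in> W" "w = p y" using VW F by blast
    have "y \<in> vertices (inflation p W K)"
      using vertices_inflation_repeated[of K y W p, OF K y(1)]
        vertices_inflation_unique[of y W p, OF y(1)] wK y(2)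
      by (auto simp: vertices_def)
    then show ?thesis using only y(2) by blast
  qed
  then have "F = {} \<or> F = {p x}" if "F \<in> K" for F using that by blast
  ultimately show ?thesis using complex_empty_face[OF K] by blast
qed

text \<open>Any copy of \<open>v\<close> is a cone apex: adding it enlarges a core by at most
  \<open>v\<close>, and every core of a face lies in \<open>{v}\<close>.\<close>

lemma nonevasive_inflation_point:
  assumes W: "finite W" and v: "v \<in> p ` W"
  shows "nonevasive (inflation p W {{}, {v}})"
proof -
  obtain x where x: "x \<in> W" "p x = v" using v by blast
  have "abstract_simplicial_complex {{}, {v}}"
    by (auto simp: abstract_simplicial_complex_def)
  then have "abstract_simplicial_complex (inflation p W {{}, {v}})"
    using W by (rule abstract_simplicial_complex_inflation)
  then show ?thesis
  proof (rule nonevasive_cone)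
    fix S assume "S \<in> inflation p W {{}, {v}}"
    moreover have "core p W (insert x S) \<subseteq> insert (p x) (core p W S)"
      by (auto simp: core_def)
    ultimately show "insert x S \<in> inflation p W {{}, {v}}"
      using x by (auto simp: inflation_def)
  qed
qed

section \<open>Induction on the number of copies\<close>

text \<open>The last assumption is an inclusion, not an equality, because in the link of a vertex
  other vertices of \<open>K\<close> may disappear while their copies stay in
  \<open>W\<close>.\<close>

theorem nonevasive_inflation_iff:
  assumes "abstract_simplicial_complex K" "finite W" "\<Union>K \<subseteq> p ` W"
  shows "nonevasive (inflation p W K) \<longleftrightarrow> nonevasive K"
  using assms
proof (induction "card W" arbitrary: W K rule: less_induct)
  case less
  note K = less.prems(1) and W = less.prems(2) and VW = less.prems(3)
  have repeated: "nonevasive (inflation p (W - {x}) K) \<longleftrightarrow> nonevasive K"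
    if x: "x \<in> W" "p x \<in> p ` (W - {x})" for x
  proof -
    have "p ` (W - {x}) = p ` W" using x by (metis insert_Diff image_insert insert_absorb)
    moreover have "card (W - {x}) < card W" using W x(1) by (rule card_Diff1_less)
    ultimately show ?thesis using less.hyps[of "W - {x}" K] K W VW by simp
  qed
  have unique:
    "nonevasive (link (inflation p W K) x) \<longleftrightarrow> nonevasive (link K (p x))"
    "nonevasive (deletion (inflation p W K) x) \<longleftrightarrow> nonevasive (deletion K (p x))"
    if x: "x \<in> W" "p x \<notin> p ` (W - {x})" "p x \<in> vertices K" for x
  proof -
    have lt: "card (W - {x}) < card W" using W x(1) by (rule card_Diff1_less)
    have fin: "finite (W - {x})" using W by simp
    \<comment> \<open>Only \<open>p x\<close> can lose its last copy, and faces of its link and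
      deletion avoid it.\<close>
    have "p ` W - {p x} \<subseteq> p ` (W - {x})" by blast
    then have "\<Union>(link K (p x)) \<subseteq> p ` (W - {x})" "\<Union>(deletion K (p x)) \<subseteq> p ` (W - {x})"
      using VW by (auto simp: link_def deletion_def)
    then show
      "nonevasive (link (inflation p W K) x) \<longleftrightarrow> nonevasive (link K (p x))"
      "nonevasive (deletion (inflation p W K) x) \<longleftrightarrow> nonevasive (deletion K (p x))"
      using less.hyps[OF lt _ fin] abstract_simplicial_complex_link[OF K x(3)]
        abstract_simplicial_complex_deletion[OF K]
        link_inflation_unique[of x W p, OF x(1,2)] deletion_inflation_unique[of x W p, OF x(1,2)]
      by simp_all
  qed
  show ?case
  proof
    assume "nonevasive (inflation p W K)"
    then show "nonevasive K"
    proof cases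
      case (point x)
      then show ?thesis using inflation_eq_pointD[OF K VW] by (simp add: nonevasive.point)
    next
      case (step x)
      have xW: "x \<in> W" using step(1) by (auto simp: vertices_def inflation_def)
      show ?thesis
      proof (cases "p x \<in> p ` (W - {x})")
        case True
        \<comment> \<open>The link is an inflation of the same \<open>K\<close> with one copy fewer,
          so it alone decides; the deletion carries no information about \<open>K\<close>.\<close>
        then show ?thesis
          using step(2) repeated[OF xW] link_inflation_repeated[of K x W p, OF K xW] by simp
      next
        case False
        then have "p x \<in> vertices K"
          using vertices_inflation_unique[of x W p, OF xW] step(1) by blast
        then show ?thesis
          using unique[OF xW False] step(2,3) by (blast intro: nonevasive.step)
      qed
    qed
  next
    assume "nonevasive K"
    then show "nonevasive (inflation p W K)"
    proof cases
      case (point v)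
      then show ?thesis using nonevasive_inflation_point[OF W, of v p] VW by simp
    next
      case (step v)
      have "v \<in> p ` W" using step(1) VW by (auto simp: vertices_def)
      then obtain x where x: "x \<in> W" "v = p x" by blast
      show ?thesis
      proof (cases "p x \<in> p ` (W - {x})")
        case True
        \<comment> \<open>Here the induction hypothesis is applied to \<open>K\<close> itself, not
          to its link at \<open>v\<close>.\<close>
        have "nonevasive (link (inflation p W K) x)"
          using \<open>nonevasive K\<close> repeated[OF x(1) True]
            link_inflation_repeated[of K x W p, OF K x(1) True] by simp
        then show ?thesis
          using vertices_inflation_repeated[of K x W p, OF K x(1) True]
            nonevasive_deletion_inflation_repeated[of K W x p, OF K W x(1) True]
          by (blast intro: nonevasive.step)
      next
        case False
        have v: "p x \<in> vertices K" using step(1) x(2) by simp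
        have "x \<in> vertices (inflation p W K)"
          using vertices_inflation_unique[of x W p, OF x(1) False] v by blast
        then show ?thesis
          using unique[OF x(1) False v] step(2,3) x(2) by (blast intro: nonevasive.step)
      qed
    qed
  qed
qed

section \<open>The wreath product as an inflation\<close>

text \<open>A set of copies fits into a wreath facet over \<open>F\<close> exactly when it misses
  some copy of each vertex outside \<open>F\<close>, that is, when its core lies in
  \<open>F\<close>.\<close>

lemma simplex_boundary_wreath_eq_inflation:
  assumes K: "abstract_simplicial_complex K"
  shows "simplex_boundary_wreath d K = inflation fst (vertices K \<times> {1..d + 1}) K"
    (is "_ = inflation fst ?W K")
proof (intro equalityI subsetI)
  fix S assume "S \<in> simplex_boundary_wreath d K"
  then obtain F c where F: "F \<in> facets K" and c: "\<forall>v\<in>vertices K - F. c v \<in> {1..d + 1}"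
    and S: "S \<subseteq> wreath_facet d K F c"
    unfolding simplex_boundary_wreath_def by blast
  have "core fst ?W S \<subseteq> F"
  proof
    fix v assume v: "v \<in> core fst ?W S"
    then have vK: "v \<in> vertices K" by (auto simp: core_def)
    show "v \<in> F"
    proof (rule ccontr)
      assume nF: "v \<notin> F"
      then have "(v, c v) \<in> ?W" using c vK by blast
      moreover have "(v, c v) \<notin> S" using S nF by (auto simp: wreath_facet_def)
      ultimately have "v \<in> fst ` (?W - S)" by force
      then show False using v by (simp add: core_def)
    qed
  qed
  moreover have "F \<in> K" using F by (simp add: facets_def)
  ultimately have "core fst ?W S \<in> K" using complex_down[OF K] by blast
  moreover have "S \<subseteq> ?W" using S by (auto simp: wreath_facet_def)
  ultimately show "S \<in> inflation fst ?W K" by (simp add: inflation_def)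
next
  fix S assume "S \<in> inflation fst ?W K"
  then have S: "S \<subseteq> ?W" and core: "core fst ?W S \<in> K" by (simp_all add: inflation_def)
  obtain F where F: "F \<in> facets K" "core fst ?W S \<subseteq> F" using facet_exists[OF K core] by blast
  \<comment> \<open>The index of a missing copy serves as the omitted index \<open>c v\<close>. The
    range \<open>{1..d + 1}\<close> is nonempty even for \<open>d = 0\<close>, so a vertex with no
    missing copy would lie in the core.\<close>
  have "\<exists>i. i \<in> {1..d + 1} \<and> (v, i) \<notin> S" if "v \<in> vertices K - F" for v
  proof (rule ccontr)
    assume "\<not> ?thesis"
    then have "v \<notin> fst ` (?W - S)" by auto
    moreover have "v \<in> fst ` ?W" using that by force
    ultimately show False using F(2) that by (auto simp: core_def)
  qed
  then obtain c where c: "\<forall>v\<in>vertices K - F. c v \<in> {1..d + 1} \<and> (v, c v) \<notin> S" by metis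
  have "S \<subseteq> wreath_facet d K F c"
    using S c unfolding wreath_facet_def by fastforce
  then show "S \<in> simplex_boundary_wreath d K"
    using F(1) c unfolding simplex_boundary_wreath_def by blast
qed

theorem corollary4p11:
  fixes K :: "'a set set" and d :: nat
  assumes "abstract_simplicial_complex K"
  shows "nonevasive (simplex_boundary_wreath d K) \<longleftrightarrow> nonevasive K"
proof -
  let ?W = "vertices K \<times> {1..d + 1}"
  have "v \<in> vertices K" if "F \<in> K" "v \<in> F" for F v
    using complex_down[OF assms that(1), of "{v}"] that(2) by (simp add: vertices_def)
  then have "\<Union>K \<subseteq> fst ` ?W" by force
  moreover have "finite ?W" using finite_vertices[OF assms] by simp
  ultimately show ?thesis
    unfolding simplex_boundary_wreath_eq_inflation[OF assms]
    using nonevasive_inflation_iff[OF assms] by blast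
qed

end
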